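(* Let $X$ and $Y$ be Banach spaces. Suppose that for every $n\in\mathbb{N}$, every $\varepsilon>0$ and all $x_1^*,\ldots,x_n^*\in B_{X^*}$, there are $y_1^*,\ldots,y_n^*\in B_{X^*}$ such that $\|x_i^*-y_i^*\|<\varepsilon$ for $i=1,\dots,n$ and $\operatorname{span}\{y_1^*,\ldots,y_n^*\}\subseteq\operatorname{NA}(X)$. Then $$\mathcal{FR}(X,Y)\subseteq\overline{\mathcal{FR}(X,Y)\cap\operatorname{RSE}(X,Y)}.$$
   Context: Banach spaces are over $\mathbb{K}$, where $\mathbb{K}=\mathbb{R}$ or $\mathbb{C}$, and are nonzero. $\mathbb{T}=\{\theta\in\mathbb{K}\colon |\theta|=1\}$; $B_X$, $S_X$ are the closed unit ball and unit sphere of $X$; $X^*$ is the dual; $\mathcal{L}(X,Y)$ is the space of bounded linear operators with the operator norm, and closures are in this norm. $\mathcal{FR}(X,Y)$ is the set of bounded finite-rank operators. $\operatorname{NA}(X)$ is the set of functionals $x^*\in X^*$ attaining their norm, i.e.\ with $|x^*(x)|=\|x^*\|$ for some $x\in B_X$. $T\in\operatorname{RSE}(X,Y)$ (range strongly exposing) means: there exists $x_0\in S_X$ such that whenever $(x_n)\subseteq B_X$ satisfies $\|Tx_n\|\to\|T\|$, there are a subsequence $(x_{\sigma(n)})$ and $\theta\in\mathbb{T}$ with $Tx_{\sigma(n)}\to\theta Tx_0$ in norm. *)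

theory Defs
  imports "HOL-Analysis.Analysis"
begin

text \<open>
  The scalar field is a type \<open>'k :: {real_normed_field, euclidean_space}\<close>. Both \<open>real\<close> and
  \<open>complex\<close> have this sort, and by the next lemma every such field is (isometrically) one of them.
\<close>

lemma scalar_field_real_or_complex:
  "(\<forall>z :: 'k :: {real_normed_field, euclidean_space}. \<exists>a. z = of_real a) \<or>
   (\<exists>i :: 'k. i\<^sup>2 = - 1 \<and>
      (\<forall>z. \<exists>a b. z = of_real a + of_real b * i \<and> norm z = sqrt (a\<^sup>2 + b\<^sup>2)))"
proof (cases "\<forall>z :: 'k. \<exists>a. z = of_real a")
  case False
  have one: "inner (1::'k) 1 = 1"
    by (simp add: dot_square_norm)
  have sq: "z\<^sup>2 = - 1" if z: "inner 1 z = 0" "norm z = 1" for z :: 'k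
  proof -
    have zz: "inner z z = 1"
      using z(2) by (simp add: dot_square_norm)
    have "(norm (1 + z))\<^sup>2 = 2" "(norm (1 - z))\<^sup>2 = 2"
      using z(1) zz one
      by (simp_all add: power2_norm_eq_inner inner_add_left inner_add_right inner_diff_left
          inner_diff_right inner_commute[of z 1])
    moreover have "1 - z\<^sup>2 = (1 + z) * (1 - z)"
      by (simp add: power2_eq_square algebra_simps)
    ultimately have "(norm (1 - z\<^sup>2))\<^sup>2 = 4"
      by (simp add: norm_mult power_mult_distrib)
    moreover have "inner (z\<^sup>2) (z\<^sup>2) = 1"
      using z(2) by (simp add: dot_square_norm norm_power)
    ultimately have "inner (1 + z\<^sup>2) (1 + z\<^sup>2) = 0"
      using one by (simp add: power2_norm_eq_inner inner_add_left inner_add_right inner_diff_left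
          inner_diff_right inner_commute[of "z\<^sup>2" 1])
    then have "1 + z\<^sup>2 = 0"
      by simp
    then show ?thesis
      by (simp add: eq_neg_iff_add_eq_0 add.commute)
  qed
  define u where "u z = z - inner 1 z *\<^sub>R 1" for z :: 'k
  have u: "inner 1 (u z) = 0" for z
    by (simp add: u_def inner_diff_right one)
  have nu: "inner 1 ((1 / norm (u z)) *\<^sub>R u z) = 0" "norm ((1 / norm (u z)) *\<^sub>R u z) = 1"
    if "u z \<noteq> 0" for z
    using that u by simp_all
  from False obtain w :: 'k where "\<And>a. w \<noteq> of_real a"
    by blast
  then have w: "u w \<noteq> 0"
    unfolding u_def of_real_def by (metis right_minus_eq)
  define i where "i = (1 / norm (u w)) *\<^sub>R u w"
  have i: "inner 1 i = 0" "norm i = 1" "i\<^sup>2 = - 1"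
    using nu[OF w] sq[OF nu[OF w]] by (simp_all only: i_def)
  have "\<exists>a b. z = of_real a + of_real b * i \<and> norm z = sqrt (a\<^sup>2 + b\<^sup>2)" for z
  proof -
    have "\<exists>b. u z = b *\<^sub>R i"
    proof (cases "u z = 0")
      case True
      then show ?thesis by (intro exI[of _ 0]) simp
    next
      case nz: False
      define v where "v = (1 / norm (u z)) *\<^sub>R u z"
      have "v\<^sup>2 = i\<^sup>2"
        using sq[OF nu[OF nz]] i by (simp add: v_def)
      then have "v = i \<or> v = - i"
        by (simp add: power2_eq_iff)
      moreover have "u z = norm (u z) *\<^sub>R v"
        using nz by (simp add: v_def)
      ultimately have "u z = norm (u z) *\<^sub>R i \<or> u z = (- norm (u z)) *\<^sub>R i"
        by auto
      then show ?thesis by blast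
    qed
    then obtain b where b: "z = inner 1 z *\<^sub>R 1 + b *\<^sub>R i"
      unfolding u_def by (metis add.commute diff_add_cancel)
    define a where "a = inner 1 z"
    have z: "z = a *\<^sub>R 1 + b *\<^sub>R i"
      using b by (simp add: a_def)
    have "inner i i = 1"
      using i(2) by (simp add: dot_square_norm)
    then have "inner z z = a\<^sup>2 + b\<^sup>2"
      unfolding z using i(1) one
      by (simp add: inner_add_left inner_add_right inner_commute[of i 1] power2_eq_square)
    then have "norm z = sqrt (a\<^sup>2 + b\<^sup>2)"
      by (simp add: norm_eq_sqrt_inner)
    then show ?thesis
      using z by (intro exI[of _ a] exI[of _ b]) (simp add: scaleR_conv_of_real)
  qed
  then show ?thesis
    using i(3) by blast
qed blast

text \<open>
  A normed space over \<open>'k\<close> is a real normed space together with a compatible multiplication by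
  scalars in \<open>'k\<close>. Completeness comes from the class \<open>banach\<close> and depends on the norm only.
\<close>

locale normed_space_over = vector_space scale
  for scale :: "'k :: {real_normed_field, euclidean_space} \<Rightarrow> 'a :: real_normed_vector \<Rightarrow> 'a" +
  assumes scale_of_real: "scale (of_real r) x = r *\<^sub>R x"
    and norm_scale: "norm (scale c x) = norm c * norm x"

lemma normed_space_over_scaleR: "normed_space_over (scaleR :: real \<Rightarrow> 'a :: real_normed_vector \<Rightarrow> 'a)"
  by unfold_locales (simp_all add: scaleR_add_right scaleR_add_left)

lemma normed_space_over_mult:
  "normed_space_over ((*) :: 'k :: {real_normed_field, euclidean_space} \<Rightarrow> 'k \<Rightarrow> 'k)"
  by unfold_locales (simp_all add: algebra_simps norm_mult scaleR_conv_of_real)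

text \<open>
  \<open>'a \<Rightarrow>\<^sub>L 'b\<close> consists of the bounded real-linear maps; \<open>\<L>(X,Y)\<close> is its closed subspace of
  \<open>'k\<close>-linear maps, with the same operator norm.
\<close>

definition bounded_operators ::
  "('k \<Rightarrow> 'a \<Rightarrow> 'a) \<Rightarrow> ('k \<Rightarrow> 'b \<Rightarrow> 'b) \<Rightarrow> ('a :: real_normed_vector \<Rightarrow>\<^sub>L 'b :: real_normed_vector) set"
  where "bounded_operators sX sY = {T. \<forall>c x. blinfun_apply T (sX c x) = sY c (blinfun_apply T x)}"

definition dual_space ::
  "('k \<Rightarrow> 'a \<Rightarrow> 'a) \<Rightarrow> ('a :: real_normed_vector \<Rightarrow>\<^sub>L 'k :: {real_normed_field, euclidean_space}) set"
  where "dual_space sX = bounded_operators sX (*)"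

definition dual_scale ::
  "'k \<Rightarrow> ('a :: real_normed_vector \<Rightarrow>\<^sub>L 'k) \<Rightarrow> ('a \<Rightarrow>\<^sub>L 'k :: {real_normed_field, euclidean_space})"
  where "dual_scale c f = blinfun_mult_right c o\<^sub>L f"

lemma dual_scale_apply: "blinfun_apply (dual_scale c f) x = c * blinfun_apply f x"
  by (simp add: dual_scale_def)

lemma normed_space_over_dual_scale:
  "normed_space_over (dual_scale ::
     'k \<Rightarrow> ('a :: real_normed_vector \<Rightarrow>\<^sub>L 'k :: {real_normed_field, euclidean_space}) \<Rightarrow> _)"
proof unfold_locales
  fix c :: 'k and f :: "'a \<Rightarrow>\<^sub>L 'k"
  have le: "norm (dual_scale d g) \<le> norm d * norm g" for d :: 'k and g :: "'a \<Rightarrow>\<^sub>L 'k"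
    by (rule norm_blinfun_bound)
      (auto simp: dual_scale_apply norm_mult mult.assoc intro!: mult_left_mono norm_blinfun)
  show "norm (dual_scale c f) = norm c * norm f"
  proof (cases "c = 0")
    case True
    then show ?thesis
      using le[of c f] by simp
  next
    case False
    then have "dual_scale (inverse c) (dual_scale c f) = f"
      by (intro blinfun_eqI) (simp add: dual_scale_apply)
    then have "norm f \<le> inverse (norm c) * norm (dual_scale c f)"
      using le[of "inverse c" "dual_scale c f"] by (simp only: norm_inverse)
    then show ?thesis
      using le[of c f] False by (simp add: field_simps)
  qed
qed (auto intro!: blinfun_eqI
    simp: dual_scale_apply blinfun.bilinear_simps algebra_simps scaleR_conv_of_real)

definition norm_attaining ::
  "('k \<Rightarrow> 'a \<Rightarrow> 'a) \<Rightarrow> ('a :: real_normed_vector \<Rightarrow>\<^sub>L 'k :: {real_normed_field, euclidean_space}) set"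
  where "norm_attaining sX =
    {f \<in> dual_space sX. \<exists>x. norm x \<le> 1 \<and> norm (blinfun_apply f x) = norm f}"

definition finite_rank ::
  "('k :: {real_normed_field, euclidean_space} \<Rightarrow> 'a \<Rightarrow> 'a) \<Rightarrow> ('k \<Rightarrow> 'b \<Rightarrow> 'b)
    \<Rightarrow> ('a :: real_normed_vector \<Rightarrow>\<^sub>L 'b :: real_normed_vector) set"
  where "finite_rank sX sY =
    {T \<in> bounded_operators sX sY. \<exists>B. finite B \<and> range (blinfun_apply T) \<subseteq> module.span sY B}"

definition range_strongly_exposing ::
  "('k :: {real_normed_field, euclidean_space} \<Rightarrow> 'a \<Rightarrow> 'a) \<Rightarrow> ('k \<Rightarrow> 'b \<Rightarrow> 'b)
    \<Rightarrow> ('a :: real_normed_vector \<Rightarrow>\<^sub>L 'b :: real_normed_vector) set"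
  where "range_strongly_exposing sX sY =
    {T \<in> bounded_operators sX sY. \<exists>x0. norm x0 = 1 \<and>
       (\<forall>x :: nat \<Rightarrow> 'a. (\<forall>n. norm (x n) \<le> 1) \<longrightarrow>
          (\<lambda>n. norm (blinfun_apply T (x n))) \<longlonglongrightarrow> norm T \<longrightarrow>
          (\<exists>(\<sigma> :: nat \<Rightarrow> nat) \<theta>. strict_mono \<sigma> \<and> norm \<theta> = 1 \<and>
             (\<lambda>n. blinfun_apply T (x (\<sigma> n))) \<longlonglongrightarrow> sY \<theta> (blinfun_apply T x0)))}"

end

theory Submission imports Defs begin

text \<open>
  Write a finite-rank operator as \<open>T x = (\<Sum>i. f i x \<cdot> v i)\<close> with \<open>f i\<close> in the dual ball. Replacing the
  \<open>f i\<close> by nearby functionals moves \<open>T\<close> only a little, so the \<open>f i\<close> may be assumed to span a space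
  of norm-attaining functionals. Then \<open>T = R \<circ> q\<close>, where \<open>q = (f i)\<^sub>i\<close> maps the unit ball of \<open>X\<close> to a
  bounded subset \<open>Q\<close> of a finite-dimensional coordinate space and \<open>R c = (\<Sum>i. c i \<cdot> v i)\<close>.

  The set \<open>Q\<close> need not be closed, and attainment by all functionals does not make it closed: a
  point of the closure can be missing from \<open>Q\<close> if it is extreme without being exposed. So \<open>T\<close> is
  perturbed so that it attains its norm at an exposed point. Let \<open>z\<close> maximise
  \<open>\<parallel>R c\<parallel> + \<delta> \<parallel>c\<parallel>\<^sup>2\<close> (Euclidean norm of \<open>c\<close>) on the closure of \<open>Q\<close>. The identity
  \<open>2 Re \<langle>c,z\<rangle> = \<parallel>c\<parallel>\<^sup>2 + \<parallel>z\<parallel>\<^sup>2 - \<parallel>c - z\<parallel>\<^sup>2\<close> turns the quadratic term into a linear one: for \<open>c\<close> in \<open>Q\<close> and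
  a suitable unimodular \<open>\<theta>\<close>,
  \<open>\<parallel>R c\<parallel> + 2\<delta> |\<langle>c,z\<rangle>| + \<delta> \<parallel>\<theta> c - z\<parallel>\<^sup>2 \<le> \<parallel>R z\<parallel> + 2\<delta> \<parallel>z\<parallel>\<^sup>2\<close>
  (\<open>maximiser_inequality\<close>). Hence \<open>c \<mapsto> \<parallel>R c\<parallel> + 2\<delta> |\<langle>c,z\<rangle>|\<close> peaks at \<open>z\<close> only, up to rotation and
  with a quadratic gap. This inequality is used twice.

  For the operator: put \<open>S x = T x + 2\<delta> \<langle>q x,z\<rangle> w\<close>, where \<open>w\<close> is the unit vector in the direction of
  \<open>R z\<close> (any unit vector if \<open>R z = 0\<close>). Then \<open>\<parallel>S x\<parallel>\<close> is at most \<open>\<parallel>R c\<parallel> + 2\<delta> |\<langle>c,z\<rangle>|\<close> at \<open>c = q x\<close>,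
  with equality in the limit \<open>q x \<rightarrow> z\<close>. So \<open>\<parallel>S x\<^sub>n\<parallel> \<rightarrow> \<parallel>S\<parallel>\<close> forces \<open>\<theta>\<^sub>n q x\<^sub>n \<rightarrow> z\<close>, and along a subsequence on which the \<open>\<theta>\<^sub>n\<close>
  converge the vectors \<open>S x\<^sub>n\<close> converge to a rotation of the value at \<open>z\<close>.

  For attainment: a norming functional for \<open>R z\<close> on the span of the \<open>v i\<close> pulls back to a functional
  \<open>c \<mapsto> (\<Sum>i. c i * a i)\<close> below \<open>\<parallel>R c\<parallel>\<close> and equal to it at \<open>z\<close> (\<open>ex_norming_coefficients\<close>). Adding
  \<open>2\<delta> \<langle>c,z\<rangle>\<close> gives, after composition with \<open>q\<close>, an element of the span of the \<open>f i\<close>. It attains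
  its norm at some \<open>x0\<close>, and the inequality forces \<open>q x0\<close> to be a rotation of \<open>z\<close>. This \<open>x0\<close> is
  the point required of \<open>S\<close>.
\<close>

section \<open>The inner product of the scalar field\<close>

text \<open>
  This is complex conjugation (the identity over the reals), defined without naming an imaginary
  unit. Its value at \<open>0\<close> is \<open>0\<close> because \<open>0 / 0 = 0\<close>.
\<close>

definition kconj :: "'k :: {real_normed_field, euclidean_space} \<Rightarrow> 'k"
  where "kconj b = of_real ((norm b)\<^sup>2) / b"

lemma norm_kconj: "norm (kconj b) = norm b"
  by (cases "b = 0") (simp_all add: kconj_def norm_divide norm_mult power2_eq_square)

lemma mult_kconj: "b * kconj b = of_real ((norm b)\<^sup>2)"
  by (simp add: kconj_def)

lemma power2_norm_diff:
  fixes x y :: "'a :: real_inner"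
  shows "(norm (x - y))\<^sup>2 = (norm x)\<^sup>2 + (norm y)\<^sup>2 - 2 * inner x y"
  using dot_norm_neg[of x y] by (simp add: field_simps)

text \<open>
  Multiplication by \<open>c\<close> scales the norm by \<open>norm c\<close>, so by polarisation it scales the inner product
  by the square.
\<close>

lemma inner_mult_left_cancel:
  fixes a b c :: "'k :: {real_normed_field, euclidean_space}"
  shows "inner (c * a) (c * b) = (norm c)\<^sup>2 * inner a b"
proof -
  have "inner (c * a) (c * b) = ((norm (c * (a + b)))\<^sup>2 - (norm (c * a))\<^sup>2 - (norm (c * b))\<^sup>2) / 2"
    by (simp add: dot_norm distrib_left)
  also have "\<dots> = (norm c)\<^sup>2 * (((norm (a + b))\<^sup>2 - (norm a)\<^sup>2 - (norm b)\<^sup>2) / 2)"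
    unfolding norm_mult power_mult_distrib by (simp add: algebra_simps)
  finally show ?thesis by (simp add: dot_norm)
qed

text \<open>
  \<open>inner 1\<close> is the real part, so this is \<open>Re (a * conj b)\<close>. It lets scalar-valued pairings be
  recovered from real inner products.
\<close>

lemma inner_eq_inner_one_kconj:
  fixes a b :: "'k :: {real_normed_field, euclidean_space}"
  shows "inner a b = inner 1 (a * kconj b)"
proof (cases "b = 0")
  case True
  then show ?thesis by (simp add: kconj_def)
next
  case False
  have "inner a b = inner (b * (a / b)) (b * 1)"
    using False by simp
  also have "\<dots> = (norm b)\<^sup>2 * inner (a / b) 1"
    by (rule inner_mult_left_cancel)
  also have "\<dots> = inner ((norm b)\<^sup>2 *\<^sub>R (a / b)) 1"
    by simp
  also have "(norm b)\<^sup>2 *\<^sub>R (a / b) = a * kconj b"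
    by (simp add: kconj_def scaleR_conv_of_real)
  finally show ?thesis by (simp add: inner_commute)
qed

lemma inner_one_of_real [simp]:
  "inner (1 :: 'k :: {real_normed_field, euclidean_space}) (of_real r) = r"
  by (simp add: of_real_def dot_square_norm)

lemma eq_of_real_if_norm_le_inner_one:
  fixes z :: "'k :: {real_normed_field, euclidean_space}"
  assumes "inner 1 z = r" "norm z \<le> r"
  shows "z = of_real r"
proof -
  have "(norm (z - of_real r))\<^sup>2 = (norm z)\<^sup>2 - 2 * r * inner 1 z + r\<^sup>2"
    using dot_norm_neg[of z "r *\<^sub>R 1"]
    by (simp add: of_real_def inner_commute)
  also have "\<dots> \<le> 0"
    using assms power_mono[OF assms(2), of 2] by (simp add: power2_eq_square)
  finally show ?thesis by simp
qed

lemma ex_unimodular_mult_eq_norm: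
  fixes z :: "'k :: real_normed_field"
  shows "\<exists>\<theta>. norm \<theta> = 1 \<and> \<theta> * z = of_real (norm z)"
proof (cases "z = 0")
  case True
  then show ?thesis by (intro exI[of _ 1]) simp
next
  case False
  then show ?thesis
    by (intro exI[of _ "of_real (norm z) / z"]) (simp add: norm_divide)
qed

section \<open>Compactness in finitely many coordinates\<close>

text \<open>
  The number of coordinates depends on the operator, so coordinate vectors are functions on a
  finite set \<open>I\<close>; passing to one further subsequence per coordinate replaces compactness of a
  product of balls.
\<close>

lemma coordinatewise_convergent_subsequence:
  fixes c :: "nat \<Rightarrow> 'i \<Rightarrow> 'k :: euclidean_space"
  assumes "finite I" and "\<And>n i. i \<in> I \<Longrightarrow> norm (c n i) \<le> M"
  shows "\<exists>\<sigma> z. strict_mono (\<sigma> :: nat \<Rightarrow> nat) \<and> (\<forall>i\<in>I. (\<lambda>n. c (\<sigma> n) i) \<longlonglongrightarrow> z i)"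
  using assms
proof (induction I rule: finite_induct)
  case empty
  show ?case by (intro exI[of _ id]) (simp add: strict_mono_def)
next
  case (insert j I)
  then obtain \<sigma> z where \<sigma>: "strict_mono (\<sigma> :: nat \<Rightarrow> nat)"
    "\<And>i. i \<in> I \<Longrightarrow> (\<lambda>n. c (\<sigma> n) i) \<longlonglongrightarrow> z i"
    by (metis insertCI)
  have "bounded (range (\<lambda>n. c (\<sigma> n) j))"
    using insert.prems by (auto simp: bounded_iff)
  then obtain l \<rho> where \<rho>: "strict_mono (\<rho> :: nat \<Rightarrow> nat)" "((\<lambda>n. c (\<sigma> n) j) \<circ> \<rho>) \<longlonglongrightarrow> l"
    using bounded_imp_convergent_subsequence by blast
  have "(\<lambda>n. c (\<sigma> (\<rho> n)) i) \<longlonglongrightarrow> (z(j := l)) i" if "i \<in> insert j I" for i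
  proof (cases "i = j")
    case True
    then show ?thesis using \<rho> by (simp add: o_def)
  next
    case False
    then show ?thesis
      using that LIMSEQ_subseq_LIMSEQ[OF \<sigma>(2) \<rho>(1), of i] by (simp add: o_def)
  qed
  moreover have "strict_mono (\<sigma> \<circ> \<rho>)"
    using \<sigma>(1) \<rho>(1) by (rule strict_mono_o)
  ultimately show ?case
    by (intro exI[of _ "\<sigma> \<circ> \<rho>"] exI[of _ "z(j := l)"]) (simp add: o_def)
qed

section \<open>Norming functionals on finite-dimensional subspaces\<close>

text \<open>
  The value \<open>\<alpha>\<close> at the new vector has to lie between all \<open>u w - \<parallel>w - v\<parallel>\<close> and all
  \<open>\<parallel>w' + v\<parallel> - u w'\<close>. The triangle inequality leaves room, and the supremum of the lower bounds is
  one choice.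
\<close>

lemma hahn_banach_one_step:
  fixes u :: "'b :: real_normed_vector \<Rightarrow> real"
  assumes u: "linear u" and dom: "\<And>y. y \<in> span A \<Longrightarrow> u y \<le> norm y"
  shows "\<exists>u'. linear u' \<and> (\<forall>y\<in>span A. u' y = u y) \<and> (\<forall>y\<in>span (insert v A). u' y \<le> norm y)"
proof (cases "v \<in> span A")
  case True
  then have "span (insert v A) = span A"
    by (rule span_redundant)
  then show ?thesis using u dom by auto
next
  case False
  have gap: "u w - norm (w - v) \<le> norm (w' + v) - u w'" if "w \<in> span A" "w' \<in> span A" for w w'
  proof -
    have "u w + u w' = u (w + w')"
      using u by (simp add: linear_add)
    also have "\<dots> \<le> norm (w + w')"
      using that by (intro dom span_add)
    also have "\<dots> \<le> norm (w - v) + norm (w' + v)"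
      using norm_triangle_ineq[of "w - v" "w' + v"] by simp
    finally show ?thesis by simp
  qed
  define \<alpha> where "\<alpha> = (SUP w\<in>span A. u w - norm (w - v))"
  have bdd: "bdd_above ((\<lambda>w. u w - norm (w - v)) ` span A)"
    using gap[OF _ span_zero] by (auto intro!: bdd_aboveI)
  have lower: "u w - norm (w - v) \<le> \<alpha>" if "w \<in> span A" for w
    unfolding \<alpha>_def using that bdd by (rule cSUP_upper)
  have upper: "\<alpha> \<le> norm (w + v) - u w" if "w \<in> span A" for w
    unfolding \<alpha>_def using that gap span_zero by (intro cSUP_least) auto
  obtain C where C: "C \<subseteq> span A" "independent C" "span A \<subseteq> span C"
    using maximal_independent_subset[of "span A"] by blast
  have spanC: "span C = span A"
    using C span_minimal[OF C(1)] by auto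
  have "independent (insert v C)"
    using False C by (simp add: independent_insert spanC)
  then obtain u' where u': "linear u'" "\<And>x. x \<in> insert v C \<Longrightarrow> u' x = (if x = v then \<alpha> else u x)"
    using linear_independent_extend[of "insert v C" "\<lambda>x. if x = v then \<alpha> else u x"] by blast
  have u'v: "u' v = \<alpha>"
    using u' by simp
  have eq: "u' y = u y" if "y \<in> span A" for y
  proof (rule linear_eq_on_span[OF u'(1) u])
    show "y \<in> span C" using that spanC by simp
    fix x assume "x \<in> C"
    then have "x \<noteq> v" using False C(1) by auto
    then show "u' x = u x" using u'(2)[of x] \<open>x \<in> C\<close> by simp
  qed
  have "u' y \<le> norm y" if "y \<in> span (insert v A)" for y
  proof -
    obtain t where t: "y - t *\<^sub>R v \<in> span A"
      using \<open>y \<in> span (insert v A)\<close> by (auto simp: span_breakdown_eq)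
    define w where "w = y - t *\<^sub>R v"
    have w: "w \<in> span A" and y: "y = w + t *\<^sub>R v"
      using t by (simp_all add: w_def)
    have u'y: "u' y = u w + t * \<alpha>"
      using u'(1) w by (simp add: y linear_add linear_scale eq u'v)
    (* Homogeneity reduces the bound to t = 1 and t = -1, the two defining bounds of \<alpha>. *)
    consider "t = 0" | "t > 0" | "t < 0" by linarith
    then show ?thesis
    proof cases
      case 1
      then show ?thesis using u'y dom w y by simp
    next
      case 2
      have "t * \<alpha> \<le> t * (norm ((1/t) *\<^sub>R w + v) - u ((1/t) *\<^sub>R w))"
        using 2 w by (intro mult_left_mono upper span_scale) auto
      also have "\<dots> = norm (t *\<^sub>R ((1/t) *\<^sub>R w + v)) - u w"
        using 2 u by (simp add: right_diff_distrib linear_scale)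
      also have "t *\<^sub>R ((1/t) *\<^sub>R w + v) = y"
        using 2 by (simp add: y scaleR_add_right)
      finally show ?thesis using u'y by simp
    next
      case 3
      have "(- t) * (u ((-1/t) *\<^sub>R w) - norm ((-1/t) *\<^sub>R w - v)) \<le> (- t) * \<alpha>"
        using 3 w by (intro mult_left_mono lower span_scale) auto
      moreover have "(- t) * (u ((-1/t) *\<^sub>R w) - norm ((-1/t) *\<^sub>R w - v))
          = u w - norm ((- t) *\<^sub>R ((-1/t) *\<^sub>R w - v))"
      proof -
        have "u ((-1/t) *\<^sub>R w) = (-1/t) *\<^sub>R u w"
          by (rule linear_scale[OF u])
        then have "(- t) * u ((-1/t) *\<^sub>R w) = u w"
          using 3 by (simp only: real_scaleR_def) simp
        then show ?thesis
          using 3 unfolding norm_scaleR by (simp add: right_diff_distrib)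
      qed
      moreover have "(- t) *\<^sub>R ((-1/t) *\<^sub>R w - v) = y"
        using 3 by (simp add: y scaleR_diff_right)
      ultimately have "u w - norm y \<le> (- t) * \<alpha>"
        by metis
      then show ?thesis using u'y by simp
    qed
  qed
  then show ?thesis using u' eq by blast
qed

lemma ex_norming_functional_on_finite_span:
  fixes y0 :: "'b :: real_normed_vector"
  assumes "finite B"
  shows "\<exists>u. linear u \<and> u y0 = norm y0 \<and> (\<forall>y\<in>span (insert y0 B). u y \<le> norm y)"
  using assms
proof (induction B rule: finite_induct)
  case empty
  show ?case
  proof (cases "y0 = 0")
    case True
    then show ?thesis
      by (intro exI[of _ "\<lambda>_. 0"]) (simp add: Real_Vector_Spaces.linear_0 linear_zero)
  next
    case False
    then obtain u where u: "linear u" "u y0 = norm y0"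
      using linear_independent_extend[of "{y0}" "\<lambda>y. norm y"] by auto
    have "u y \<le> norm y" if "y \<in> span {y0}" for y
    proof -
      obtain k where "y = k *\<^sub>R y0"
        using \<open>y \<in> span {y0}\<close> unfolding span_singleton by blast
      then show ?thesis
        using u by (simp add: linear_scale mult_right_mono)
    qed
    then show ?thesis using u by auto
  qed
next
  case (insert v B)
  then obtain u where u: "linear u" "u y0 = norm y0" "\<And>y. y \<in> span (insert y0 B) \<Longrightarrow> u y \<le> norm y"
    by blast
  obtain u' where "linear u'" "\<forall>y\<in>span (insert y0 B). u' y = u y"
      "\<forall>y\<in>span (insert v (insert y0 B)). u' y \<le> norm y"
    using hahn_banach_one_step[OF u(1,3)] by blast
  then show ?case
    using u(2) by (intro exI[of _ u']) (auto simp: insert_commute span_base)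
qed

context normed_space_over
begin

lemma bounded_bilinear_scale: "bounded_bilinear scale"
proof
  show "\<exists>K. \<forall>c x. norm (scale c x) \<le> norm c * norm x * K"
    by (intro exI[of _ 1]) (simp add: norm_scale)
  fix r :: real and c :: 'k and x
  show "scale (r *\<^sub>R c) x = r *\<^sub>R scale c x"
    by (simp add: scaleR_conv_of_real flip: scale_of_real)
  show "scale c (r *\<^sub>R x) = r *\<^sub>R scale c x"
    by (simp add: mult.commute flip: scale_of_real)
qed (simp_all add: scale_left_distrib scale_right_distrib)

lemmas tendsto_scale = bounded_bilinear.tendsto[OF bounded_bilinear_scale]

lemma norm_scale_sum_mult:
  "norm (\<Sum>i\<in>I. scale (\<theta> * c i) (v i)) = norm \<theta> * norm (\<Sum>i\<in>I. scale (c i) (v i))"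
  by (simp add: norm_scale flip: scale_scale scale_sum_right)

text \<open>
  The real Hahn-Banach functional \<open>u\<close> on the real span of all \<open>scale b (v i)\<close> is the real part of a
  scalar-linear functional. The coefficient \<open>a i\<close> represents \<open>c \<mapsto> u (scale c (v i))\<close> in the
  inner product of the field, conjugated. Rotating the argument turns the bound on the real part
  into a bound on the modulus.
\<close>

lemma ex_norming_coefficients:
  assumes "finite I"
  shows "\<exists>a. (\<forall>c. norm (\<Sum>i\<in>I. c i * a i) \<le> norm (\<Sum>i\<in>I. scale (c i) (v i))) \<and>
    (\<Sum>i\<in>I. z i * a i) = of_real (norm (\<Sum>i\<in>I. scale (z i) (v i)))"
proof -
  define R where "R c = (\<Sum>i\<in>I. scale (c i) (v i))" for c
  define B where "B = (\<lambda>(i, b). scale b (v i)) ` (I \<times> Basis)"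
  have "finite B"
    using assms by (simp add: B_def)
  then obtain u where u: "linear u" "u (R z) = norm (R z)"
    "\<And>y. y \<in> real_vector.span (insert (R z) B) \<Longrightarrow> u y \<le> norm y"
    using ex_norming_functional_on_finite_span[of B "R z"] by blast
  have expand: "scale c (v i) = (\<Sum>b\<in>Basis. inner c b *\<^sub>R scale b (v i))" for c i
    by (subst euclidean_representation[of c, symmetric])
      (simp add: bounded_bilinear.sum_left[OF bounded_bilinear_scale]
        bounded_bilinear.scaleR_left[OF bounded_bilinear_scale])
  have mem: "R c \<in> real_vector.span (insert (R z) B)" for c
  proof -
    have "scale (c i) (v i) \<in> real_vector.span (insert (R z) B)" if "i \<in> I" for i
      unfolding expand[of "c i" i] using that
      by (intro real_vector.span_sum real_vector.span_scale real_vector.span_base insertI2)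
        (auto simp: B_def)
    then show ?thesis
      unfolding R_def[of c] by (rule real_vector.span_sum)
  qed
  define a where "a i = kconj (\<Sum>b\<in>Basis. u (scale b (v i)) *\<^sub>R b)" for i
  have ua: "u (R c) = inner 1 (\<Sum>i\<in>I. c i * a i)" for c
  proof -
    have "u (scale (c i) (v i)) = inner 1 (c i * a i)" for i
    proof -
      have "u (scale (c i) (v i)) = (\<Sum>b\<in>Basis. inner (c i) b * u (scale b (v i)))"
        by (subst expand) (simp add: linear_sum[OF u(1)] linear_scale[OF u(1)])
      also have "\<dots> = inner (c i) (\<Sum>b\<in>Basis. u (scale b (v i)) *\<^sub>R b)"
        by (simp add: inner_sum_right mult.commute)
      finally show ?thesis
        by (simp only: a_def inner_eq_inner_one_kconj[of "c i"])
    qed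
    then show ?thesis
      using u(1) by (simp add: R_def linear_sum inner_sum_right)
  qed
  have le: "norm (\<Sum>i\<in>I. c i * a i) \<le> norm (R c)" for c
  proof -
    obtain \<theta> where \<theta>: "norm \<theta> = 1" "\<theta> * (\<Sum>i\<in>I. c i * a i) = of_real (norm (\<Sum>i\<in>I. c i * a i))"
      using ex_unimodular_mult_eq_norm by blast
    have "norm (\<Sum>i\<in>I. c i * a i) = u (R (\<lambda>i. \<theta> * c i))"
      unfolding ua using \<theta>(2) by (simp add: sum_distrib_left mult.assoc)
    also have "\<dots> \<le> norm (R (\<lambda>i. \<theta> * c i))"
      by (rule u(3)[OF mem])
    also have "\<dots> = norm (R c)"
      using \<theta>(1) by (simp add: R_def norm_scale_sum_mult)
    finally show ?thesis .
  qed
  moreover have "(\<Sum>i\<in>I. z i * a i) = of_real (norm (R z))"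
    using ua u(2) le by (intro eq_of_real_if_norm_le_inner_one) auto
  ultimately show ?thesis unfolding R_def by blast
qed

section \<open>Finite-rank operators as sums of rank-one operators\<close>

text \<open>
  Otherwise there are coefficient vectors of \<open>\<ell>\<^sub>1\<close>-norm one whose combinations tend to \<open>0\<close>; a limit of
  them would be a nontrivial linear relation in \<open>B\<close>. This makes the coordinate functionals of a
  finite-rank operator continuous.
\<close>

lemma coefficients_bounded_by_norm:
  assumes "finite B" "independent B"
  shows "\<exists>K>0. \<forall>c. (\<Sum>b\<in>B. norm (c b)) \<le> K * norm (\<Sum>b\<in>B. scale (c b) b)"
proof (rule ccontr)
  assume "\<not> ?thesis"
  then have "\<forall>n :: nat. \<exists>c. real (Suc n) * norm (\<Sum>b\<in>B. scale (c b) b) < (\<Sum>b\<in>B. norm (c b))"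
    by (metis not_le of_nat_0_less_iff zero_less_Suc)
  then obtain c :: "nat \<Rightarrow> 'a \<Rightarrow> 'k" where
    c: "\<And>n. real (Suc n) * norm (\<Sum>b\<in>B. scale (c n b) b) < (\<Sum>b\<in>B. norm (c n b))"
    by metis
  define s where "s n = (\<Sum>b\<in>B. norm (c n b))" for n
  have s: "s n > 0" for n
    using c[of n] by (simp add: s_def le_less_trans[rotated])
  define d where "d n b = of_real (1 / s n) * c n b" for n b
  have d1: "(\<Sum>b\<in>B. norm (d n b)) = 1" for n
    using s[of n] unfolding d_def norm_mult
    by (simp add: s_def[symmetric] norm_divide flip: sum_distrib_left sum_divide_distrib)
  have dR: "norm (\<Sum>b\<in>B. scale (d n b) b) \<le> 1 / real (Suc n)" for n
    using c[of n] s[of n] unfolding d_def norm_scale_sum_mult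
    by (simp add: s_def[symmetric] norm_divide field_simps)
  have "norm (d n b) \<le> 1" if "b \<in> B" for n b
    using member_le_sum[of b B "\<lambda>b. norm (d n b)"] that assms(1) d1[of n] by simp
  then obtain \<sigma> z where \<sigma>: "strict_mono (\<sigma> :: nat \<Rightarrow> nat)"
    "\<And>b. b \<in> B \<Longrightarrow> (\<lambda>n. d (\<sigma> n) b) \<longlonglongrightarrow> z b"
    using coordinatewise_convergent_subsequence[OF assms(1), of d 1] by blast
  have "(\<lambda>n. \<Sum>b\<in>B. norm (d (\<sigma> n) b)) \<longlonglongrightarrow> (\<Sum>b\<in>B. norm (z b))"
    by (intro tendsto_sum tendsto_norm \<sigma>)
  then have z1: "(\<Sum>b\<in>B. norm (z b)) = 1"
    by (simp add: d1 LIMSEQ_const_iff)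
  have "(\<lambda>n. \<Sum>b\<in>B. scale (d (\<sigma> n) b) b) \<longlonglongrightarrow> (\<Sum>b\<in>B. scale (z b) b)"
    by (intro tendsto_sum tendsto_scale \<sigma> tendsto_const)
  moreover have "(\<lambda>n. \<Sum>b\<in>B. scale (d n b) b) \<longlonglongrightarrow> 0"
    by (rule Lim_null_comparison[OF _ LIMSEQ_inverse_real_of_nat])
      (use dR in \<open>simp add: inverse_eq_divide\<close>)
  then have "(\<lambda>n. \<Sum>b\<in>B. scale (d (\<sigma> n) b) b) \<longlonglongrightarrow> 0"
    using LIMSEQ_subseq_LIMSEQ[OF _ \<sigma>(1)] by (fastforce simp: o_def)
  ultimately have "(\<Sum>b\<in>B. scale (z b) b) = 0"
    by (rule LIMSEQ_unique)
  then have "z b = 0" if "b \<in> B" for b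
    using assms that independentD by blast
  then show False using z1 by simp
qed

definition rank_one :: "('x :: real_normed_vector \<Rightarrow>\<^sub>L 'k) \<Rightarrow> 'a \<Rightarrow> 'x \<Rightarrow>\<^sub>L 'a"
  where "rank_one f v = Blinfun (\<lambda>x. scale (blinfun_apply f x) v)"

lemma rank_one_apply [simp]: "blinfun_apply (rank_one f v) x = scale (blinfun_apply f x) v"
proof -
  have "bounded_linear (\<lambda>x. scale (blinfun_apply f x) v)"
    by (intro bounded_linear_compose[OF
          bounded_bilinear.bounded_linear_left[OF bounded_bilinear_scale]]
        blinfun.bounded_linear_right)
  then show ?thesis by (simp add: rank_one_def bounded_linear_Blinfun_apply)
qed

lemma norm_rank_one_le: "norm (rank_one f v) \<le> norm f * norm v"
proof (rule norm_blinfun_bound)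
  fix x
  show "norm (blinfun_apply (rank_one f v) x) \<le> norm f * norm v * norm x"
    using mult_right_mono[OF norm_blinfun[of f x], of "norm v"]
    by (simp add: norm_scale mult.commute mult.left_commute)
qed simp

lemma sum_rank_one_apply:
  "blinfun_apply (\<Sum>i\<in>I. rank_one (f i) (v i)) x = (\<Sum>i\<in>I. scale (blinfun_apply (f i) x) (v i))"
  by (simp add: blinfun.sum_left)

lemma sum_rank_one_in_finite_rank:
  assumes "finite I" "\<And>i. i \<in> I \<Longrightarrow> f i \<in> dual_space sX"
  shows "(\<Sum>i\<in>I. rank_one (f i) (v i)) \<in> finite_rank sX scale"
proof -
  have "(\<Sum>i\<in>I. rank_one (f i) (v i)) \<in> bounded_operators sX scale"
    using assms(2) unfolding dual_space_def bounded_operators_def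
    by (simp add: sum_rank_one_apply scale_sum_right)
  moreover have "range (blinfun_apply (\<Sum>i\<in>I. rank_one (f i) (v i))) \<subseteq> span (v ` I)"
    unfolding sum_rank_one_apply by (intro image_subsetI span_sum span_scale span_base imageI)
  ultimately show ?thesis
    using assms(1) unfolding finite_rank_def by blast
qed

text \<open>
  The \<open>f i\<close> are the coordinates of \<open>T x\<close> in a basis of a finite-dimensional space containing the
  range, and the \<open>v i\<close> are the basis vectors. A common factor is moved from the functionals to the
  vectors, which brings the functionals into the dual ball.
\<close>

lemma finite_rank_eq_sum_rank_one:
  assumes "T \<in> finite_rank sX scale"
  shows "\<exists>(n :: nat) f v. (\<forall>i\<in>{1..n}. f i \<in> dual_space sX \<and> norm (f i) \<le> 1) \<and>
    T = (\<Sum>i\<in>{1..n}. rank_one (f i) (v i))"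
proof -
  obtain B0 where B0: "finite B0" "range (blinfun_apply T) \<subseteq> span B0"
    and lin: "\<And>c x. blinfun_apply T (sX c x) = scale c (blinfun_apply T x)"
    using assms by (auto simp: finite_rank_def bounded_operators_def)
  obtain B where B: "B \<subseteq> B0" "independent B" "span B0 \<subseteq> span B"
    using maximal_independent_subset[of B0] span_mono span_span by (metis span_minimal subspace_span)
  have fin: "finite B" and range: "\<And>x. blinfun_apply T x \<in> span B"
    using B0 B finite_subset by auto
  define g where "g b x = representation B (blinfun_apply T x) b" for b x
  have Tg: "blinfun_apply T x = (\<Sum>b\<in>B. scale (g b x) b)" for x
    unfolding g_def using sum_representation_eq[OF B(2) range fin order_refl] by simp
  obtain K where K: "K > 0" "\<And>c. (\<Sum>b\<in>B. norm (c b)) \<le> K * norm (\<Sum>b\<in>B. scale (c b) b)"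
    using coefficients_bounded_by_norm[OF fin B(2)] by blast
  have g_bound: "norm (g b x) \<le> norm x * (K * norm T)" if "b \<in> B" for b x
  proof -
    have "norm (g b x) \<le> (\<Sum>b\<in>B. norm (g b x))"
      using that fin by (intro member_le_sum) auto
    also have "\<dots> \<le> K * norm (blinfun_apply T x)"
      using K(2)[of "\<lambda>b. g b x"] by (simp add: Tg)
    also have "\<dots> \<le> K * (norm T * norm x)"
      using K(1) by (intro mult_left_mono norm_blinfun) auto
    finally show ?thesis by (simp add: mult_ac)
  qed
  have g_add: "g b (x + y) = g b x + g b y" for b x y
    unfolding g_def by (simp add: blinfun.add_right representation_add[OF B(2) range range])
  have g_scale: "g b (sX c x) = c * g b x" for b c x
    unfolding g_def by (simp add: lin representation_scale[OF B(2) range])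
  have g_scaleR: "g b (r *\<^sub>R x) = r *\<^sub>R g b x" for b r x
    unfolding g_def
    using representation_scale[OF B(2) range[of x], of "of_real r" ]
    by (simp add: blinfun.scaleR_right scaleR_conv_of_real flip: scale_of_real)
  have g_bl: "bounded_linear (g b)" if "b \<in> B" for b
    by (rule bounded_linear_intro[OF g_add g_scaleR g_bound[OF that]])
  define F where "F b = Blinfun (g b)" for b
  have F: "blinfun_apply (F b) x = g b x" if "b \<in> B" for b x
    using g_bl[OF that] by (simp add: F_def bounded_linear_Blinfun_apply)
  define C where "C = 1 + (\<Sum>b\<in>B. norm (F b))"
  have C: "C > 0"
    by (simp add: C_def add_pos_nonneg sum_nonneg)
  have F_le: "norm (F b) \<le> C" if "b \<in> B" for b
    using that fin member_le_sum[of b B "\<lambda>b. norm (F b)"] by (simp add: C_def)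
  obtain h where h: "bij_betw h {1..card B} B"
    using ex_bij_betw_nat_finite_1[OF fin] by blast
  have hB: "h i \<in> B" if "i \<in> {1..card B}" for i
    using h that by (auto simp: bij_betw_def)
  show ?thesis
  proof (intro exI conjI ballI)
    fix i assume i: "i \<in> {1..card B}"
    show "(1 / C) *\<^sub>R F (h i) \<in> dual_space sX"
      using hB[OF i] by (simp add: dual_space_def bounded_operators_def blinfun.scaleR_left F g_scale)
    show "norm ((1 / C) *\<^sub>R F (h i)) \<le> 1"
      using F_le[OF hB[OF i]] C by simp
  next
    show "T = (\<Sum>i\<in>{1..card B}. rank_one ((1 / C) *\<^sub>R F (h i)) (C *\<^sub>R h i))"
    proof (rule blinfun_eqI)
      fix x
      have "(\<Sum>i\<in>{1..card B}. scale (g (h i) x) (h i)) = blinfun_apply T x"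
        unfolding Tg by (rule sum.reindex_bij_betw[OF h])
      moreover have "scale (blinfun_apply ((1 / C) *\<^sub>R F (h i)) x) (C *\<^sub>R h i) = scale (g (h i) x) (h i)"
        if "i \<in> {1..card B}" for i
        using hB[OF that] C
        by (simp add: blinfun.scaleR_left F bounded_bilinear.scaleR_left[OF bounded_bilinear_scale]
            bounded_bilinear.scaleR_right[OF bounded_bilinear_scale])
      ultimately show "blinfun_apply T x
          = blinfun_apply (\<Sum>i\<in>{1..card B}. rank_one ((1 / C) *\<^sub>R F (h i)) (C *\<^sub>R h i)) x"
        unfolding sum_rank_one_apply by (metis (no_types, lifting) sum.cong)
    qed
  qed
qed

section \<open>The perturbation\<close>

text \<open>
  The trick that turns a maximum of a function with a quadratic term into a strict maximum of one
  with a linear term. Choose \<open>\<theta>\<close> so that \<open>\<langle>\<theta> c, z\<rangle> = |\<langle>c,z\<rangle>|\<close> and expand \<open>\<parallel>\<theta> c - z\<parallel>\<^sup>2\<close>.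
\<close>

lemma maximiser_inequality:
  fixes c z :: "'i \<Rightarrow> 'k" and v :: "'i \<Rightarrow> 'a" and \<delta> :: real
  assumes max: "norm (\<Sum>i\<in>I. scale (c i) (v i)) + \<delta> * (\<Sum>i\<in>I. (norm (c i))\<^sup>2)
    \<le> norm (\<Sum>i\<in>I. scale (z i) (v i)) + \<delta> * (\<Sum>i\<in>I. (norm (z i))\<^sup>2)"
  shows "\<exists>\<theta>. norm \<theta> = 1 \<and>
    norm (\<Sum>i\<in>I. scale (c i) (v i)) + 2 * \<delta> * norm (\<Sum>i\<in>I. c i * kconj (z i))
      + \<delta> * (\<Sum>i\<in>I. (norm (\<theta> * c i - z i))\<^sup>2)
    \<le> norm (\<Sum>i\<in>I. scale (z i) (v i)) + 2 * \<delta> * (\<Sum>i\<in>I. (norm (z i))\<^sup>2)"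
proof -
  obtain \<theta> where \<theta>: "norm \<theta> = 1"
    "\<theta> * (\<Sum>i\<in>I. c i * kconj (z i)) = of_real (norm (\<Sum>i\<in>I. c i * kconj (z i)))"
    using ex_unimodular_mult_eq_norm by blast
  have ip: "(\<Sum>i\<in>I. inner (\<theta> * c i) (z i)) = norm (\<Sum>i\<in>I. c i * kconj (z i))"
  proof -
    have "(\<Sum>i\<in>I. inner (\<theta> * c i) (z i)) = inner 1 (\<theta> * (\<Sum>i\<in>I. c i * kconj (z i)))"
      by (simp add: inner_eq_inner_one_kconj[of "\<theta> * _"] inner_sum_right sum_distrib_left mult.assoc)
    then show ?thesis by (simp add: \<theta>(2))
  qed
  have "(norm (\<theta> * c i - z i))\<^sup>2 = (norm (c i))\<^sup>2 + (norm (z i))\<^sup>2 - 2 * inner (\<theta> * c i) (z i)" for i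
  proof -
    have "(norm (\<theta> * c i - z i))\<^sup>2 = (norm (\<theta> * c i))\<^sup>2 + (norm (z i))\<^sup>2 - 2 * inner (\<theta> * c i) (z i)"
      by (rule power2_norm_diff)
    then show ?thesis using \<theta>(1) by (simp add: norm_mult)
  qed
  then have sq: "(\<Sum>i\<in>I. (norm (\<theta> * c i - z i))\<^sup>2) = (\<Sum>i\<in>I. (norm (c i))\<^sup>2) + (\<Sum>i\<in>I. (norm (z i))\<^sup>2)
      - 2 * norm (\<Sum>i\<in>I. c i * kconj (z i))"
    by (simp add: sum.distrib sum_subtractf flip: sum_distrib_left ip)
  have "norm (\<Sum>i\<in>I. scale (c i) (v i)) + 2 * \<delta> * norm (\<Sum>i\<in>I. c i * kconj (z i))
      + \<delta> * (\<Sum>i\<in>I. (norm (\<theta> * c i - z i))\<^sup>2)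
    \<le> norm (\<Sum>i\<in>I. scale (z i) (v i)) + 2 * \<delta> * (\<Sum>i\<in>I. (norm (z i))\<^sup>2)"
    using max unfolding sq by (simp add: algebra_simps)
  then show ?thesis using \<theta>(1) by blast
qed

text \<open>
  The maximiser \<open>z\<close> lies in the closure of \<open>Q\<close> but in general not in \<open>Q\<close>; the sequence \<open>d\<close>
  approaching it serves to evaluate suprema over \<open>Q\<close> at \<open>z\<close>.
\<close>

lemma ex_limit_maximiser:
  fixes I :: "'i set" and Q :: "('i \<Rightarrow> 'k) set" and v :: "'i \<Rightarrow> 'a" and \<delta> :: real
  defines "\<Phi> \<equiv> \<lambda>c. norm (\<Sum>i\<in>I. scale (c i) (v i)) + \<delta> * (\<Sum>i\<in>I. (norm (c i))\<^sup>2)"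
  assumes "finite I" and Q: "\<And>c i. c \<in> Q \<Longrightarrow> i \<in> I \<Longrightarrow> norm (c i) \<le> 1" "Q \<noteq> {}" and "\<delta> > 0"
  obtains d z where "\<And>n :: nat. d n \<in> Q" "\<And>i. i \<in> I \<Longrightarrow> (\<lambda>n. d n i) \<longlonglongrightarrow> z i"
    "\<And>c. c \<in> Q \<Longrightarrow> \<Phi> c \<le> \<Phi> z"
proof -
  have "\<Phi> c \<le> (\<Sum>i\<in>I. norm (v i)) + \<delta> * card I" if "c \<in> Q" for c
  proof -
    have "norm (\<Sum>i\<in>I. scale (c i) (v i)) \<le> (\<Sum>i\<in>I. norm (v i))"
      using Q(1)[OF that] by (intro sum_norm_le) (simp add: norm_scale mult_left_le_one_le)
    moreover have "(\<Sum>i\<in>I. (norm (c i))\<^sup>2) \<le> card I"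
      using sum_mono[of I "\<lambda>i. (norm (c i))\<^sup>2" "\<lambda>_. 1"] Q(1)[OF that]
      by (simp add: power_le_one)
    ultimately show ?thesis
      unfolding \<Phi>_def using \<open>\<delta> > 0\<close> by (intro add_mono mult_left_mono) auto
  qed
  then have bdd: "bdd_above (\<Phi> ` Q)"
    by (rule bdd_aboveI2)
  define m where "m = (SUP c\<in>Q. \<Phi> c)"
  have m: "\<Phi> c \<le> m" if "c \<in> Q" for c
    unfolding m_def using that bdd by (rule cSUP_upper)
  have "\<exists>c\<in>Q. m - 1 / real (Suc n) < \<Phi> c" for n
    using less_cSUP_iff[OF Q(2) bdd, of "m - 1 / real (Suc n)"] by (simp add: m_def)
  then obtain d where d: "\<And>n. d n \<in> Q" "\<And>n. m - 1 / real (Suc n) < \<Phi> (d n)"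
    by metis
  have "(\<lambda>n. m - 1 / real (Suc n)) \<longlonglongrightarrow> m - 0"
    using LIMSEQ_inverse_real_of_nat by (intro tendsto_diff tendsto_const) (simp add: inverse_eq_divide)
  then have "(\<lambda>n. m - 1 / real (Suc n)) \<longlonglongrightarrow> m"
    by (simp only: diff_zero)
  note sandwich = tendsto_sandwich[OF _ _ this tendsto_const]
  have lim: "(\<lambda>n. \<Phi> (d n)) \<longlonglongrightarrow> m"
    by (rule sandwich) (rule always_eventually allI less_imp_le d m)+
  obtain \<sigma> z where \<sigma>: "strict_mono (\<sigma> :: nat \<Rightarrow> nat)"
    "\<And>i. i \<in> I \<Longrightarrow> (\<lambda>n. d (\<sigma> n) i) \<longlonglongrightarrow> z i"
    using coordinatewise_convergent_subsequence[OF \<open>finite I\<close>, of d 1] d(1) Q(1) by blast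
  have "(\<lambda>n. \<Phi> (d (\<sigma> n))) \<longlonglongrightarrow> \<Phi> z"
    unfolding \<Phi>_def by (intro tendsto_intros tendsto_scale \<sigma>)
  moreover have "(\<lambda>n. \<Phi> (d (\<sigma> n))) \<longlonglongrightarrow> m"
    using LIMSEQ_subseq_LIMSEQ[OF lim \<sigma>(1)] by (simp add: o_def)
  ultimately have "\<Phi> z = m"
    by (rule LIMSEQ_unique)
  then show thesis
    using that[of "\<lambda>n. d (\<sigma> n)" z] d(1) \<sigma>(2) m by metis
qed

text \<open>
  Below, \<open>q\<close> and \<open>R\<close> factor the given operator, \<open>ip c\<close> is \<open>\<langle>c,z\<rangle>\<close>, \<open>G\<close> is the functional that exposes
  \<open>z\<close>, and \<open>N\<close> is both the norm of \<open>G\<close> and the norm of the perturbed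
  operator. The perturbation has size at most \<open>2\<delta> \<parallel>z\<parallel>\<^sub>1\<close>, and each coordinate of \<open>z\<close> is at most one
  in modulus.
\<close>

lemma perturb_sum_rank_one_to_range_strongly_exposing:
  fixes sX :: "'k \<Rightarrow> 'x :: real_normed_vector \<Rightarrow> 'x" and f :: "'i \<Rightarrow> 'x \<Rightarrow>\<^sub>L 'k" and \<delta> :: real
  assumes X: "\<exists>x :: 'x. x \<noteq> 0" and Y: "\<exists>y :: 'a. y \<noteq> 0"
    and I: "finite I" and f: "\<And>i. i \<in> I \<Longrightarrow> f i \<in> dual_space sX \<and> norm (f i) \<le> 1"
    and NA: "module.span dual_scale (f ` I) \<subseteq> norm_attaining sX"
    and \<delta>: "\<delta> > 0"
  obtains S where "S \<in> finite_rank sX scale \<inter> range_strongly_exposing sX scale"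
    "norm (S - (\<Sum>i\<in>I. rank_one (f i) (v i))) \<le> 2 * \<delta> * card I"
proof -
  define R where "R c = (\<Sum>i\<in>I. scale (c i) (v i))" for c
  define q where "q x = (\<lambda>i. blinfun_apply (f i) x)" for x
  have q_bound: "norm (q x i) \<le> 1" if "norm x \<le> 1" "i \<in> I" for x i
    using norm_blinfun[of "f i" x] f[OF that(2)] that(1) mult_mono[of "norm (f i)" 1 "norm x" 1]
    by (simp add: q_def)
  obtain d z where d: "\<And>n :: nat. d n \<in> q ` {x. norm x \<le> 1}"
    and z: "\<And>i. i \<in> I \<Longrightarrow> (\<lambda>n. d n i) \<longlonglongrightarrow> z i"
    and max: "\<And>c. c \<in> q ` {x. norm x \<le> 1} \<Longrightarrow>
      norm (R c) + \<delta> * (\<Sum>i\<in>I. (norm (c i))\<^sup>2) \<le> norm (R z) + \<delta> * (\<Sum>i\<in>I. (norm (z i))\<^sup>2)"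
  proof (rule ex_limit_maximiser[where I = I and Q = "q ` {x. norm x \<le> 1}" and \<delta> = \<delta> and v = v])
    show "q ` {x. norm x \<le> 1} \<noteq> {}"
      by (auto intro!: exI[of _ 0])
  qed (use I q_bound \<delta> in \<open>auto simp: R_def\<close>)
  obtain x' where x': "\<And>n. norm (x' n) \<le> 1" "\<And>n. d n = q (x' n)"
    using d by (simp add: image_iff) metis
  have z_le: "norm (z i) \<le> 1" if "i \<in> I" for i
    using z[OF that] x' q_bound that
    by (intro tendsto_upperbound[OF tendsto_norm[OF z[OF that]]]) auto
  define N where "N = norm (R z) + 2 * \<delta> * (\<Sum>i\<in>I. (norm (z i))\<^sup>2)"
  define ip where "ip c = (\<Sum>i\<in>I. c i * kconj (z i))" for c
  have key: "\<exists>\<theta>. norm \<theta> = 1 \<and> norm (R (q x)) + 2 * \<delta> * norm (ip (q x))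
      + \<delta> * (\<Sum>i\<in>I. (norm (\<theta> * q x i - z i))\<^sup>2) \<le> N" if "norm x \<le> 1" for x
    using maximiser_inequality[where I = I and c = "q x" and v = v and z = z and \<delta> = \<delta>] max[of "q x"] that
    unfolding R_def N_def ip_def by blast
  have ip_z: "ip z = of_real (\<Sum>i\<in>I. (norm (z i))\<^sup>2)"
    by (simp add: ip_def mult_kconj)
  (* G attains its norm because it lies in the span of the f i; since |G x| <= |R (q x)| + 2 \<delta> |ip (q x)|
     and G has norm N, it can only do so over a rotation of z. *)
  obtain a where a: "\<And>c. norm (\<Sum>i\<in>I. c i * a i) \<le> norm (R c)"
    "(\<Sum>i\<in>I. z i * a i) = of_real (norm (R z))"
    using ex_norming_coefficients[OF I, of v z] unfolding R_def by blast
  define G where "G = (\<Sum>i\<in>I. dual_scale (a i + of_real (2 * \<delta>) * kconj (z i)) (f i))"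
  have G: "blinfun_apply G x = (\<Sum>i\<in>I. q x i * a i) + of_real (2 * \<delta>) * ip (q x)" for x
    by (simp add: G_def blinfun.sum_left dual_scale_apply q_def ip_def sum_distrib_left
        algebra_simps sum.distrib)
  interpret D: normed_space_over "dual_scale :: 'k \<Rightarrow> ('x \<Rightarrow>\<^sub>L 'k) \<Rightarrow> _"
    by (rule normed_space_over_dual_scale)
  have "G \<in> D.span (f ` I)"
    unfolding G_def by (intro D.span_sum D.span_scale D.span_base) auto
  then obtain x0 where x0: "norm x0 \<le> 1" "norm (blinfun_apply G x0) = norm G"
    using NA unfolding norm_attaining_def by blast
  have "norm G \<ge> N"
  proof (rule tendsto_upperbound)
    have "(\<lambda>n. blinfun_apply G (x' n)) \<longlonglongrightarrow> (\<Sum>i\<in>I. z i * a i) + of_real (2 * \<delta>) * ip z"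
      unfolding G ip_def x'(2)[symmetric] by (intro tendsto_intros z)
    also have "(\<Sum>i\<in>I. z i * a i) + of_real (2 * \<delta>) * ip z = of_real N"
      by (simp add: a(2) ip_z N_def)
    finally have "(\<lambda>n. norm (blinfun_apply G (x' n))) \<longlonglongrightarrow> norm (of_real N :: 'k)"
      by (rule tendsto_norm)
    moreover have "N \<ge> 0"
      using \<delta> by (simp add: N_def sum_nonneg)
    ultimately show "(\<lambda>n. norm (blinfun_apply G (x' n))) \<longlonglongrightarrow> N"
      by simp
    have "norm (blinfun_apply G (x' n)) \<le> norm G" for n
      using norm_blinfun[of G "x' n"] x'(1)[of n] mult_left_le[of "norm (x' n)" "norm G"] by simp
    then show "\<forall>\<^sub>F n in sequentially. norm (blinfun_apply G (x' n)) \<le> norm G"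
      by simp
  qed simp
  moreover have "norm (blinfun_apply G x0) \<le> norm (R (q x0)) + 2 * \<delta> * norm (ip (q x0))"
    unfolding G using a(1)[of "q x0"] \<delta>
    by (intro order_trans[OF norm_triangle_ineq]) (simp add: norm_mult)
  moreover obtain \<theta>0 where \<theta>0: "norm \<theta>0 = 1" "norm (R (q x0)) + 2 * \<delta> * norm (ip (q x0))
      + \<delta> * (\<Sum>i\<in>I. (norm (\<theta>0 * q x0 i - z i))\<^sup>2) \<le> N"
    using key[OF x0(1)] by blast
  ultimately have "\<delta> * (\<Sum>i\<in>I. (norm (\<theta>0 * q x0 i - z i))\<^sup>2) \<le> 0"
    using x0(2) by linarith
  then have "(\<Sum>i\<in>I. (norm (\<theta>0 * q x0 i - z i))\<^sup>2) = 0"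
    using \<delta> by (intro antisym sum_nonneg) (auto simp: mult_le_0_iff)
  then have qx0: "\<theta>0 * q x0 i = z i" if "i \<in> I" for i
    using I that by (simp add: sum_nonneg_eq_0_iff)
  (* w points along R z, so that R z and the added term reinforce each other at z without
     cancellation; if R z = 0, any unit vector does. *)
  obtain w where w: "norm w = 1" "R z = norm (R z) *\<^sub>R w"
  proof (cases "R z = 0")
    case True
    obtain y :: 'a where "y \<noteq> 0" using Y by blast
    then show thesis using that[of "(1 / norm y) *\<^sub>R y"] True by simp
  next
    case False
    then show thesis using that[of "(1 / norm (R z)) *\<^sub>R R z"] by simp
  qed
  define R' where "R' c = R c + scale (of_real (2 * \<delta>) * ip c) w" for c
  define S where "S = (\<Sum>i\<in>I. rank_one (f i) (v i + scale (of_real (2 * \<delta>) * kconj (z i)) w))"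
  have S: "blinfun_apply S x = R' (q x)" for x
    by (simp add: S_def sum_rank_one_apply R'_def R_def ip_def q_def scale_right_distrib sum.distrib
        sum_distrib_left scale_sum_left mult_ac)
  have R'_scale: "R' (\<lambda>i. \<theta> * c i) = scale \<theta> (R' c)" for \<theta> c
    by (simp add: R'_def R_def ip_def scale_right_distrib scale_sum_right sum_distrib_left mult_ac)
  have R'_cong: "R' c = R' c'" if "\<And>i. i \<in> I \<Longrightarrow> c i = c' i" for c c'
    using that by (simp add: R'_def R_def ip_def)
  have "R' z = N *\<^sub>R w"
  proof -
    have "R' z = norm (R z) *\<^sub>R w + scale (of_real (2 * \<delta> * (\<Sum>i\<in>I. (norm (z i))\<^sup>2))) w"
      unfolding R'_def ip_z using w(2) by simp
    then show ?thesis by (simp add: N_def scale_of_real scaleR_add_left del: of_real_mult of_real_sum)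
  qed
  then have R'_z: "norm (R' z) = N"
    using w(1) \<delta> by (simp add: N_def sum_nonneg)
  have R'_le: "norm (R' c) \<le> norm (R c) + 2 * \<delta> * norm (ip c)" for c
    unfolding R'_def using w(1) \<delta>
    by (intro order_trans[OF norm_triangle_ineq]) (simp add: norm_scale norm_mult)
  have S_key: "\<exists>\<theta>. norm \<theta> = 1 \<and> norm (blinfun_apply S x)
      + \<delta> * (\<Sum>i\<in>I. (norm (\<theta> * q x i - z i))\<^sup>2) \<le> N" if "norm x \<le> 1" for x
    using key[OF that] R'_le[of "q x"] unfolding S by fastforce
  have S_le: "norm (blinfun_apply S x) \<le> N" if "norm x \<le> 1" for x
  proof -
    obtain \<theta> where "norm (blinfun_apply S x) + \<delta> * (\<Sum>i\<in>I. (norm (\<theta> * q x i - z i))\<^sup>2) \<le> N"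
      using S_key[OF \<open>norm x \<le> 1\<close>] by blast
    moreover have "\<delta> * (\<Sum>i\<in>I. (norm (\<theta> * q x i - z i))\<^sup>2) \<ge> 0"
      using \<delta> by (simp add: sum_nonneg)
    ultimately show ?thesis by linarith
  qed
  have S_x0: "scale \<theta>0 (blinfun_apply S x0) = R' z"
    unfolding S R'_scale[symmetric] by (rule R'_cong) (use qx0 in auto)
  then have norm_S_x0: "norm (blinfun_apply S x0) = N"
    using R'_z \<theta>0(1) norm_scale[of \<theta>0 "blinfun_apply S x0"] by simp
  have norm_S: "norm S = N"
  proof (rule antisym)
    show "norm S \<le> N"
    proof (rule norm_blinfun_bound)
      show "0 \<le> N" using norm_S_x0 by (metis norm_ge_zero)
      fix x
      show "norm (blinfun_apply S x) \<le> N * norm x"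
      proof (cases "x = 0")
        case False
        have "norm (blinfun_apply S ((1 / norm x) *\<^sub>R x)) \<le> N"
          using False by (intro S_le) simp
        then show ?thesis
          using False by (simp add: blinfun.scaleR_right field_simps)
      qed simp
    qed
    show "N \<le> norm S"
      using norm_blinfun[of S x0] x0(1) mult_left_le[of "norm x0" "norm S"] norm_S_x0 by simp
  qed
  have S_FR: "S \<in> finite_rank sX scale"
    unfolding S_def using f by (intro sum_rank_one_in_finite_rank I) auto
  have conv: "\<exists>(\<sigma> :: nat \<Rightarrow> nat) \<theta>. strict_mono \<sigma> \<and> norm \<theta> = 1 \<and>
      (\<lambda>n. blinfun_apply S (x (\<sigma> n))) \<longlonglongrightarrow> scale \<theta> (blinfun_apply S x0)"
    if x: "\<And>n. norm (x n) \<le> 1" "(\<lambda>n. norm (blinfun_apply S (x n))) \<longlonglongrightarrow> norm S" for x :: "nat \<Rightarrow> 'x"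
  proof -
    obtain \<theta> where \<theta>: "\<And>n. norm (\<theta> n) = 1" "\<And>n. norm (blinfun_apply S (x n))
        + \<delta> * (\<Sum>i\<in>I. (norm (\<theta> n * q (x n) i - z i))\<^sup>2) \<le> N"
      using S_key[OF x(1)] by metis
    have lim: "(\<lambda>n. \<theta> n * q (x n) i) \<longlonglongrightarrow> z i" if "i \<in> I" for i
    proof -
      have bound: "norm ((norm (\<theta> n * q (x n) i - z i))\<^sup>2) \<le> (N - norm (blinfun_apply S (x n))) / \<delta>" for n
      proof -
        have "(norm (\<theta> n * q (x n) i - z i))\<^sup>2 \<le> (\<Sum>i\<in>I. (norm (\<theta> n * q (x n) i - z i))\<^sup>2)"
          using I that by (intro member_le_sum) auto
        also have "\<dots> \<le> (N - norm (blinfun_apply S (x n))) / \<delta>"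
          using \<theta>(2)[of n] \<delta> by (simp add: pos_le_divide_eq mult.commute)
        finally show ?thesis by simp
      qed
      have "(\<lambda>n. (N - norm (blinfun_apply S (x n))) / \<delta>) \<longlonglongrightarrow> (N - N) / \<delta>"
        using x(2) \<delta> unfolding norm_S by (intro tendsto_divide tendsto_diff tendsto_const) simp_all
      then have "(\<lambda>n. (N - norm (blinfun_apply S (x n))) / \<delta>) \<longlonglongrightarrow> 0"
        by (simp only: diff_self div_0)
      then have "(\<lambda>n. (norm (\<theta> n * q (x n) i - z i))\<^sup>2) \<longlonglongrightarrow> 0"
        by (rule Lim_null_comparison[OF always_eventually[OF allI[OF bound]]])
      from tendsto_real_sqrt[OF this] have "(\<lambda>n. norm (\<theta> n * q (x n) i - z i)) \<longlonglongrightarrow> 0"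
        by simp
      then show ?thesis
        by (simp add: tendsto_norm_zero_iff LIM_zero_iff)
    qed
    (* Only the phases can still oscillate. *)
    have "bounded (range \<theta>)"
      using \<theta>(1) by (auto simp: bounded_iff)
    then obtain l \<sigma> where \<sigma>: "strict_mono (\<sigma> :: nat \<Rightarrow> nat)" "(\<theta> \<circ> \<sigma>) \<longlonglongrightarrow> l"
      using bounded_imp_convergent_subsequence by blast
    have l: "norm l = 1"
      using tendsto_norm[OF \<sigma>(2)] \<theta>(1) by (simp add: LIMSEQ_const_iff)
    then have "l \<noteq> 0" by auto
    have "(\<lambda>n. q (x (\<sigma> n)) i) \<longlonglongrightarrow> inverse l * z i" if "i \<in> I" for i
    proof -
      have "(\<lambda>n. inverse (\<theta> (\<sigma> n)) * (\<theta> (\<sigma> n) * q (x (\<sigma> n)) i)) \<longlonglongrightarrow> inverse l * z i"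
        using \<sigma>(2) \<open>l \<noteq> 0\<close> LIMSEQ_subseq_LIMSEQ[OF lim[OF that] \<sigma>(1)]
        by (intro tendsto_intros) (auto simp: o_def)
      moreover have "inverse (\<theta> n) * (\<theta> n * q (x n) i) = q (x n) i" for n
        using \<theta>(1)[of n] by (cases "\<theta> n = 0") (simp_all flip: mult.assoc)
      ultimately show ?thesis by (simp only:)
    qed
    then have "(\<lambda>n. blinfun_apply S (x (\<sigma> n))) \<longlonglongrightarrow> R' (\<lambda>i. inverse l * z i)"
      unfolding S R'_def R_def ip_def by (intro tendsto_intros tendsto_scale)
    moreover have "R' (\<lambda>i. inverse l * z i) = scale (inverse l * \<theta>0) (blinfun_apply S x0)"
      unfolding R'_scale S_x0[symmetric] by simp
    ultimately show ?thesis
      using \<sigma>(1) l \<theta>0(1)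
      by (intro exI[of _ \<sigma>] exI[of _ "inverse l * \<theta>0"]) (simp add: norm_mult norm_inverse)
  qed
  have S_RSE: "S \<in> range_strongly_exposing sX scale"
  proof -
    (* The point x0 has norm one as soon as S is nonzero; for S = 0 every unit vector will do. *)
    obtain x1 where x1: "norm x1 = 1" "blinfun_apply S x1 = blinfun_apply S x0"
    proof (cases "S = 0")
      case True
      obtain x :: 'x where "x \<noteq> 0" using X by blast
      then show thesis using that[of "(1 / norm x) *\<^sub>R x"] True by simp
    next
      case False
      have "norm S * 1 \<le> norm S * norm x0"
        using norm_blinfun[of S x0] norm_S_x0 norm_S by simp
      then have "1 \<le> norm x0"
        using False by simp
      then show thesis using that[of x0] x0(1) by simp
    qed
    then show ?thesis
      using S_FR conv unfolding range_strongly_exposing_def finite_rank_def by auto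
  qed
  have "S - (\<Sum>i\<in>I. rank_one (f i) (v i))
      = (\<Sum>i\<in>I. rank_one (f i) (scale (of_real (2 * \<delta>) * kconj (z i)) w))"
    unfolding S_def by (rule blinfun_eqI)
      (simp add: blinfun.diff_left blinfun.sum_left scale_right_distrib sum.distrib)
  also have "norm \<dots> \<le> (\<Sum>i\<in>I. 2 * \<delta>)"
  proof (rule sum_norm_le)
    fix i assume i: "i \<in> I"
    have "norm (rank_one (f i) (scale (of_real (2 * \<delta>) * kconj (z i)) w))
        \<le> norm (f i) * (2 * \<delta> * norm (z i))"
      using norm_rank_one_le[of "f i" "scale (of_real (2 * \<delta>) * kconj (z i)) w"] w(1) \<delta>
      by (simp add: norm_scale norm_mult norm_kconj)
    also have "\<dots> \<le> 1 * (2 * \<delta> * 1)"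
      using f[OF i] z_le[OF i] \<delta> by (intro mult_mono) auto
    finally show "norm (rank_one (f i) (scale (of_real (2 * \<delta>) * kconj (z i)) w)) \<le> 2 * \<delta>"
      by simp
  qed
  finally show thesis
    using that S_FR S_RSE by (simp add: mult.commute)
qed

end

section \<open>Density\<close>

theorem theorem3p17:
  fixes sX :: "'k :: {real_normed_field, euclidean_space} \<Rightarrow> 'a :: banach \<Rightarrow> 'a"
    and sY :: "'k \<Rightarrow> 'b :: banach \<Rightarrow> 'b"
  assumes "normed_space_over sX" and "normed_space_over sY"
    and "\<exists>x :: 'a. x \<noteq> 0" and "\<exists>y :: 'b. y \<noteq> 0"
    and "\<And>(n :: nat) (\<epsilon> :: real) (x :: nat \<Rightarrow> 'a \<Rightarrow>\<^sub>L 'k).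
      \<epsilon> > 0 \<Longrightarrow> (\<forall>i\<in>{1..n}. x i \<in> dual_space sX \<and> norm (x i) \<le> 1) \<Longrightarrow>
      \<exists>y :: nat \<Rightarrow> 'a \<Rightarrow>\<^sub>L 'k.
        (\<forall>i\<in>{1..n}. y i \<in> dual_space sX \<and> norm (y i) \<le> 1 \<and> norm (x i - y i) < \<epsilon>) \<and>
        module.span dual_scale (y ` {1..n}) \<subseteq> norm_attaining sX"
  shows "finite_rank sX sY \<subseteq> closure (finite_rank sX sY \<inter> range_strongly_exposing sX sY)"
proof
  interpret Y: normed_space_over sY by fact
  fix T assume "T \<in> finite_rank sX sY"
  from Y.finite_rank_eq_sum_rank_one[OF this] obtain n :: nat and f v
    where f: "\<forall>i\<in>{1..n}. f i \<in> dual_space sX \<and> norm (f i) \<le> 1"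
      and T: "T = (\<Sum>i\<in>{1..n}. Y.rank_one (f i) (v i))"
    by (elim exE conjE)
  show "T \<in> closure (finite_rank sX sY \<inter> range_strongly_exposing sX sY)"
    unfolding closure_approachable
  proof (intro allI impI)
    fix e :: real assume e: "e > 0"
    (* Half of e is spent on each replacement; the added 1 avoids division by zero. *)
    define V where "V = 1 + (\<Sum>i\<in>{1..n}. norm (v i))"
    have V: "V > 0"
      by (simp add: V_def add_pos_nonneg sum_nonneg)
    obtain y where y: "\<And>i. i \<in> {1..n} \<Longrightarrow> y i \<in> dual_space sX \<and> norm (y i) \<le> 1"
        "\<And>i. i \<in> {1..n} \<Longrightarrow> norm (f i - y i) < e / (2 * V)"
      and NA: "module.span dual_scale (y ` {1..n}) \<subseteq> norm_attaining sX"
    proof -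
      have "e / (2 * V) > 0"
        using e V by simp
      from assms(5)[OF this f] show thesis
        using that by blast
    qed
    define \<delta> where "\<delta> = e / (4 * (real n + 1))"
    have \<delta>: "\<delta> > 0" "2 * \<delta> * real n < e / 2"
      using e by (simp_all add: \<delta>_def field_simps)
    obtain S where S: "S \<in> finite_rank sX sY \<inter> range_strongly_exposing sX sY"
      "norm (S - (\<Sum>i\<in>{1..n}. Y.rank_one (y i) (v i))) \<le> 2 * \<delta> * card {1..n}"
      using Y.perturb_sum_rank_one_to_range_strongly_exposing[OF assms(3,4) finite_atLeastAtMost y(1) NA \<delta>(1), of v]
      by blast
    have "T - (\<Sum>i\<in>{1..n}. Y.rank_one (y i) (v i)) = (\<Sum>i\<in>{1..n}. Y.rank_one (f i - y i) (v i))"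
      unfolding T by (rule blinfun_eqI)
        (simp add: blinfun.diff_left blinfun.sum_left Y.scale_left_diff_distrib sum_subtractf)
    also have "norm \<dots> \<le> (\<Sum>i\<in>{1..n}. e / (2 * V) * norm (v i))"
    proof (rule sum_norm_le)
      fix i assume i: "i \<in> {1..n}"
      show "norm (Y.rank_one (f i - y i) (v i)) \<le> e / (2 * V) * norm (v i)"
        using Y.norm_rank_one_le[of "f i - y i" "v i"] mult_right_mono[OF less_imp_le[OF y(2)[OF i]], of "norm (v i)"]
        by simp
    qed
    also have "\<dots> = e / (2 * V) * (V - 1)"
      by (simp add: V_def sum_distrib_left)
    also have "\<dots> \<le> e / 2"
      using e V by (simp add: field_simps)
    finally have "norm (T - (\<Sum>i\<in>{1..n}. Y.rank_one (y i) (v i))) \<le> e / 2" .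
    moreover have "norm (S - T) \<le> norm (S - (\<Sum>i\<in>{1..n}. Y.rank_one (y i) (v i)))
        + norm (T - (\<Sum>i\<in>{1..n}. Y.rank_one (y i) (v i)))"
      using norm_triangle_ineq4[of "S - (\<Sum>i\<in>{1..n}. Y.rank_one (y i) (v i))"
          "T - (\<Sum>i\<in>{1..n}. Y.rank_one (y i) (v i))"] by simp
    ultimately have "norm (S - T) < e"
      using S(2) \<delta>(2) by simp
    then show "\<exists>S\<in>finite_rank sX sY \<inter> range_strongly_exposing sX sY. dist S T < e"
      using S(1) by (intro bexI[of _ S]) (simp only: dist_norm)
  qed
qed

end
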